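(* Let $k$ be a field with $\operatorname{char}(k)\ne2$. Let $J=ke_0\oplus V\oplus ke_1$ be the reduced spin factor of a non-degenerate anisotropic quadratic space $(k,V,q)$ with base point $u$. Let $X$ be a non-trivial special $J$-module, with action $\bullet$, equipped with a $k$-bilinear skew-symmetric form $\beta:X\times X\to J$ satisfying, for all $j\in J$ and $x,y\in X$, the (equivalent) identities $$U_j\beta(x,y)=\beta(j\bullet x,j\bullet y),\qquad j\,\beta(x,y)=\tfrac12\bigl(\beta(j\bullet x,y)+\beta(x,j\bullet y)\bigr).$$ Let $X_0=\{x\in X\mid e_0\bullet x=x\}$ and assume that $$\beta(v\bullet x,x)\bullet x=v\bullet\bigl(u\bullet(\beta(u\bullet x,x)\bullet x)\bigr)\quad\text{for all }x\in X_0,\ v\in V,$$ $$\beta(u\bullet x,x)\ne0\quad\text{for all }x\in X_0\setminus\{0\}.$$ Define $$\cdot:X_0\times V\to X_0:\ x\cdot v=v\bullet(u\bullet x),\qquad h:X_0\times X_0\to V:\ h(x,y)=\beta(u\bullet x,y).$$ Then $(k,V,q,u,X_0,\cdot,h)$ is a quadrangular algebra.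
   Context: A Jordan $k$-algebra is a unital commutative $k$-algebra with $(x^2y)x=x^2(yx)$; $U_xy:=2x(xy)-x^2y$. Reduced spin factor: for a quadratic form $q:V\to k$ with associated bilinear form $f(v,w)=q(v+w)-q(v)-q(w)$, it is the Jordan algebra $J=ke_0\oplus V\oplus ke_1$ with commutative product $(t_1e_i)(t_2e_j)=\delta_{ij}t_1t_2e_i$, $(te_i)v=\tfrac12tv$, $vw=\tfrac12f(v,w)(e_0+e_1)$ for $i,j\in\{0,1\}$, $t,t_1,t_2\in k$, $v,w\in V$. Its unit is $e_0+e_1$. A base point of $q$ is an element $u\in V$ with $q(u)=1$. A special $J$-module is a $k$-vector space $X$ with a $k$-bilinear action $\bullet:J\times X\to X$ such that $1\bullet x=x$ and $(U_jj')\bullet x=j\bullet(j'\bullet(j\bullet x))$ for all $j,j'\in J$, $x\in X$. A quadrangular algebra (over $k$ with $\operatorname{char}(k)\ne2$) is a 7-tuple $(k,L,q,1,X,\cdot,h)$ with $L$ a $k$-vector space, $q:L\to k$ an anisotropic quadratic form, $1\in L$ with $q(1)=1$, $X$ a nontrivial $k$-vector space, and maps $X\times L\to X:(x,v)\mapsto x\cdot v$ (also written $xv$), $h:X\times X\to L$ such that, with $f(v,w)=q(v+w)-q(v)-q(w)$, $v^\sigma=f(1,v)1-v$, $v^{-1}=v^\sigma/q(v)$, for all $x,y\in X$, $v\in L$: (A1) $\cdot$ is $k$-bilinear; (A2) $x\cdot1=x$; (A3) $(xv)v^{-1}=x$ for $v\ne0$; (B1) $h$ is $k$-bilinear; (B2)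 $h(x,yv)=h(y,xv)+f(h(x,y),1)v$; (B3) $f(h(xv,y),1)=f(h(x,y),v)$; (C) $\theta(x,v):=\tfrac12h(x,xv)$; (D1) with $\pi(x)=\theta(x,1)$, $x\theta(x,v)=(x\pi(x))v$; (D2) $\pi(x)\ne0$ for $x\ne0$. *)

theory Defs
  imports Complex_Main "HOL-Library.Product_Plus"
begin

section \<open>Bilinear maps and quadratic forms\<close>

text \<open>
  Vector spaces over a field \<open>'k\<close> are given by a scalar multiplication as in the library locale
  \<open>vector_space\<close>. Some of the spaces below occur as subspaces of an ambient space; they are then
  represented by their carrier sets, and a map on them is only constrained on the carriers.
\<close>

definition bilinear_on ::
  "('k::field \<Rightarrow> 'a::ab_group_add \<Rightarrow> 'a) \<Rightarrow> 'a set \<Rightarrow> ('k \<Rightarrow> 'b::ab_group_add \<Rightarrow> 'b) \<Rightarrow> 'b set \<Rightarrow>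
   ('k \<Rightarrow> 'c::ab_group_add \<Rightarrow> 'c) \<Rightarrow> 'c set \<Rightarrow> ('a \<Rightarrow> 'b \<Rightarrow> 'c) \<Rightarrow> bool" where
  "bilinear_on sA A sB B sC C b \<longleftrightarrow>
     (\<forall>x\<in>A. \<forall>y\<in>B. b x y \<in> C) \<and>
     (\<forall>x\<in>A. \<forall>x'\<in>A. \<forall>y\<in>B. b (x + x') y = b x y + b x' y) \<and>
     (\<forall>x\<in>A. \<forall>y\<in>B. \<forall>y'\<in>B. b x (y + y') = b x y + b x y') \<and>
     (\<forall>t. \<forall>x\<in>A. \<forall>y\<in>B. b (sA t x) y = sC t (b x y)) \<and>
     (\<forall>t. \<forall>x\<in>A. \<forall>y\<in>B. b x (sB t y) = sC t (b x y))"

definition polar :: "('v::ab_group_add \<Rightarrow> 'k::field) \<Rightarrow> 'v \<Rightarrow> 'v \<Rightarrow> 'k" where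
  "polar q v w = q (v + w) - q v - q w"

definition quadratic_form_on ::
  "('k::field \<Rightarrow> 'v::ab_group_add \<Rightarrow> 'v) \<Rightarrow> 'v set \<Rightarrow> ('v \<Rightarrow> 'k) \<Rightarrow> bool" where
  "quadratic_form_on s V q \<longleftrightarrow>
     (\<forall>t. \<forall>v\<in>V. q (s t v) = t\<^sup>2 * q v) \<and> bilinear_on s V s V (*) UNIV (polar q)"

definition anisotropic_on :: "'v::ab_group_add set \<Rightarrow> ('v \<Rightarrow> 'k::field) \<Rightarrow> bool" where
  "anisotropic_on V q \<longleftrightarrow> (\<forall>v\<in>V. q v = 0 \<longrightarrow> v = 0)"

definition nondegenerate_on :: "'v::ab_group_add set \<Rightarrow> ('v \<Rightarrow> 'k::field) \<Rightarrow> bool" where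
  "nondegenerate_on V q \<longleftrightarrow> (\<forall>v\<in>V. (\<forall>w\<in>V. polar q v w = 0) \<longrightarrow> v = 0)"


section \<open>Jordan algebras and their special modules\<close>

locale jordan_algebra = vector_space scale
  for scale :: "'k::field \<Rightarrow> 'j::ab_group_add \<Rightarrow> 'j" +
  fixes mul :: "'j \<Rightarrow> 'j \<Rightarrow> 'j" and unit :: 'j
  assumes mul_bilinear: "bilinear_on scale UNIV scale UNIV scale UNIV mul"
    and mul_commute: "mul x y = mul y x"
    and unit_mul: "mul unit x = x"
    and jordan_identity: "mul (mul (mul x x) y) x = mul (mul x x) (mul y x)"

definition U_operator ::
  "('k::field \<Rightarrow> 'j::ab_group_add \<Rightarrow> 'j) \<Rightarrow> ('j \<Rightarrow> 'j \<Rightarrow> 'j) \<Rightarrow> 'j \<Rightarrow> 'j \<Rightarrow> 'j" where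
  "U_operator scale mul x y = scale 2 (mul x (mul x y)) - mul (mul x x) y"

locale special_jordan_module =
  jordan_algebra scaleJ mul unit + X: vector_space scaleX
  for scaleJ :: "'k::field \<Rightarrow> 'j::ab_group_add \<Rightarrow> 'j" and mul unit
    and scaleX :: "'k \<Rightarrow> 'x::ab_group_add \<Rightarrow> 'x" +
  fixes act :: "'j \<Rightarrow> 'x \<Rightarrow> 'x"
  assumes act_bilinear: "bilinear_on scaleJ UNIV scaleX UNIV scaleX UNIV act"
    and unit_act: "act unit x = x"
    and U_act: "act (U_operator scaleJ mul j j') x = act j (act j' (act j x))"


section \<open>Reduced spin factors\<close>

text \<open>
  The element \<open>t\<^sub>0 e\<^sub>0 + v + t\<^sub>1 e\<^sub>1\<close> of the reduced spin factor is represented by the triple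
  \<open>(t\<^sub>0, v, t\<^sub>1)\<close>; addition is the componentwise addition of the library.
\<close>

type_synonym ('k, 'v) spin = "'k \<times> 'v \<times> 'k"

definition spin_e0 :: "('k::field, 'v::ab_group_add) spin" where
  "spin_e0 = (1, 0, 0)"

definition spin_e1 :: "('k::field, 'v::ab_group_add) spin" where
  "spin_e1 = (0, 0, 1)"

definition spin_V :: "'v::ab_group_add \<Rightarrow> ('k::field, 'v) spin" where
  "spin_V v = (0, v, 0)"

definition spin_V_part :: "('k::field, 'v::ab_group_add) spin \<Rightarrow> 'v" where
  "spin_V_part j = fst (snd j)"

definition spin_scale ::
  "('k::field \<Rightarrow> 'v::ab_group_add \<Rightarrow> 'v) \<Rightarrow> 'k \<Rightarrow> ('k, 'v) spin \<Rightarrow> ('k, 'v) spin" where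
  "spin_scale s t = (\<lambda>(a, v, b). (t * a, s t v, t * b))"

text \<open>
  The bilinear extension of the rules \<open>e\<^sub>i e\<^sub>j = \<delta>\<^sub>i\<^sub>j e\<^sub>i\<close>, \<open>e\<^sub>i v = v e\<^sub>i = v / 2\<close> and
  \<open>v w = (f(v, w) / 2) (e\<^sub>0 + e\<^sub>1)\<close>, where \<open>f\<close> is the polar form of \<open>q\<close>.
\<close>

definition spin_mul ::
  "('k::field \<Rightarrow> 'v::ab_group_add \<Rightarrow> 'v) \<Rightarrow> ('v \<Rightarrow> 'k) \<Rightarrow>
   ('k, 'v) spin \<Rightarrow> ('k, 'v) spin \<Rightarrow> ('k, 'v) spin" where
  "spin_mul s q = (\<lambda>(a, v, b) (c, w, d).
     (a * c + 1/2 * polar q v w,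
      s (1/2 * (a + b)) w + s (1/2 * (c + d)) v,
      b * d + 1/2 * polar q v w))"

definition spin_unit :: "('k::field, 'v::ab_group_add) spin" where
  "spin_unit = spin_e0 + spin_e1"

lemma two_neq_zero_if_char: "(2::'k::field) \<noteq> 0" if "CHAR('k) \<noteq> 2"
proof
  assume "(2::'k) = 0"
  then have "of_nat 2 = (0::'k)" by simp
  then have "CHAR('k) dvd 2" by (simp only: of_nat_eq_0_iff_char_dvd)
  then have "CHAR('k) \<le> 2" "CHAR('k) \<noteq> 0"
    by (auto dest: dvd_imp_le intro!: Nat.gr0I)
  with that have "CHAR('k) = 1" by linarith
  then have "of_nat 1 = (0::'k)" by (simp only: of_nat_eq_0_iff_char_dvd) simp
  then show False by simp
qed

lemma jordan_algebra_spin: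
  fixes s :: "'k::field \<Rightarrow> 'v::ab_group_add \<Rightarrow> 'v"
  assumes "CHAR('k) \<noteq> 2" and "vector_space s" and q: "quadratic_form_on s UNIV q"
  shows "jordan_algebra (spin_scale s) (spin_mul s q) spin_unit"
proof -
  interpret vector_space s by fact
  have two: "(2::'k) \<noteq> 0" by (rule two_neq_zero_if_char) fact
  have p: "polar q (x + x') y = polar q x y + polar q x' y"
      "polar q x (y + y') = polar q x y + polar q x y'"
      "polar q (s t x) y = t * polar q x y" "polar q x (s t y) = t * polar q x y"
    for x x' y y' t
    using q unfolding quadratic_form_on_def bilinear_on_def by auto
  have comm: "polar q x y = polar q y x" for x y
    by (simp add: polar_def add.commute)
  have p0: "polar q 0 y = 0" "polar q y 0 = 0" for y
    using p(3)[of 0 0 y] p(4)[of y 0 0] by simp_all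
  have mul_comm: "spin_mul s q x y = spin_mul s q y x" for x y
    by (cases x; cases y) (simp add: spin_mul_def comm add.commute mult.commute)
  have mul_add: "spin_mul s q x (y + z) = spin_mul s q x y + spin_mul s q x z" for x y z
    by (cases x; cases y; cases z)
      (simp add: spin_mul_def p scale_right_distrib scale_left_distrib distrib_left
        add_divide_distrib)
  have mul_scale: "spin_mul s q x (spin_scale s t y) = spin_scale s t (spin_mul s q x y)" for t x y
    by (cases x; cases y)
      (simp add: spin_mul_def spin_scale_def p scale_right_distrib scale_left_distrib distrib_left
        add_divide_distrib mult.left_commute mult.commute)
  have mul_add': "spin_mul s q (y + z) x = spin_mul s q y x + spin_mul s q z x" for x y z
    by (simp only: mul_comm[of _ x] mul_add)
  have mul_scale': "spin_mul s q (spin_scale s t y) x = spin_scale s t (spin_mul s q y x)" for t x y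
    by (simp only: mul_comm[of _ x] mul_scale)
  have mul_unit: "spin_mul s q spin_unit x = x" for x
    using two by (cases x) (simp add: spin_mul_def spin_unit_def spin_e0_def spin_e1_def p0)
  show ?thesis
  proof
    show "spin_scale s a (x + y) = spin_scale s a x + spin_scale s a y" for a x y
      by (cases x; cases y) (simp add: spin_scale_def scale_right_distrib distrib_left)
    show "spin_scale s (a + b) x = spin_scale s a x + spin_scale s b x" for a b x
      by (cases x) (simp add: spin_scale_def scale_left_distrib distrib_right)
    show "spin_scale s a (spin_scale s b x) = spin_scale s (a * b) x" for a b x
      by (cases x) (simp add: spin_scale_def mult.assoc)
    show "spin_scale s 1 x = x" for x
      by (cases x) (simp add: spin_scale_def)
    show "bilinear_on (spin_scale s) UNIV (spin_scale s) UNIV (spin_scale s) UNIV (spin_mul s q)"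
      unfolding bilinear_on_def by (simp add: mul_add mul_scale mul_add' mul_scale')
    show "spin_mul s q x y = spin_mul s q y x" for x y
      by (rule mul_comm)
    show "spin_mul s q spin_unit x = x" for x
      by (rule mul_unit)
    show "spin_mul s q (spin_mul s q (spin_mul s q x x) y) x =
        spin_mul s q (spin_mul s q x x) (spin_mul s q y x)" for x y
    proof -
      obtain a v b where x: "x = (a, v, b)" by (cases x) auto
      define n where "n = 1/2 * polar q v v - a * b"
      have "z / 2 + z / 2 = z" for z :: 'k
        using two by (metis add_divide_distrib mult_2 nonzero_mult_div_cancel_left)
      then have half: "s ((a + b) / 2) v + s ((a + b) / 2) v = s (a + b) v"
        by (metis scale_left_distrib)
      have xx: "spin_mul s q x x = spin_scale s (a + b) x + spin_scale s n spin_unit"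
        by (simp add: x spin_mul_def n_def half spin_scale_def spin_unit_def spin_e0_def
            spin_e1_def algebra_simps)
      have "spin_mul s q (spin_mul s q x x) z =
          spin_scale s (a + b) (spin_mul s q x z) + spin_scale s n z" for z
        unfolding xx mul_add' mul_scale' mul_unit ..
      then show ?thesis
        by (simp add: mul_add' mul_scale' mul_comm[of y x] mul_comm[of "spin_mul s q x y" x])
    qed
  qed
qed

text \<open>
  The two compatibility conditions between a bilinear map \<open>\<beta>\<close> into a Jordan algebra and a special
  module structure are equivalent.
\<close>

lemma (in special_jordan_module) U_compatible_iff_mul_compatible:
  assumes "CHAR('k) \<noteq> 2" and \<beta>: "bilinear_on scaleX UNIV scaleX UNIV scaleJ UNIV \<beta>"
  shows "(\<forall>j x y. U_operator scaleJ mul j (\<beta> x y) = \<beta> (act j x) (act j y)) \<longleftrightarrow>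
    (\<forall>j x y. mul j (\<beta> x y) = scaleJ (1/2) (\<beta> (act j x) y + \<beta> x (act j y)))"
    (is "?U \<longleftrightarrow> ?M")
proof -
  have two: "(2::'k) \<noteq> 0" by (rule two_neq_zero_if_char) fact
  note b = \<beta>[unfolded bilinear_on_def, simplified]
  note m = mul_bilinear[unfolded bilinear_on_def, simplified]
  note ac = act_bilinear[unfolded bilinear_on_def, simplified]
  have um: "mul x unit = x" for x by (metis mul_commute unit_mul)
  have double: "scaleJ 2 z = z + z" for z
    using scale_left_distrib[of 1 1 z] by simp
  have half: "scaleJ (1/2) z + scaleJ (1/2) z = z" for z
    using two by (simp flip: scale_left_distrib add: field_simps)
  have sq: "act j (act j x) = act (mul j j) x" for j x
    using U_act[of j unit x] by (simp add: U_operator_def um unit_act double)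
  show ?thesis
  proof
    assume U: ?U
    show ?M
    proof (intro allI)
      fix j x y
      have "U_operator scaleJ mul (j + unit) (\<beta> x y) =
          U_operator scaleJ mul j (\<beta> x y) + \<beta> x y + (mul j (\<beta> x y) + mul j (\<beta> x y))"
        by (simp add: U_operator_def double m um unit_mul)
      moreover have "U_operator scaleJ mul (j + unit) (\<beta> x y) =
          \<beta> (act j x) (act j y) + \<beta> x y + (\<beta> (act j x) y + \<beta> x (act j y))"
        using U by (simp add: ac b unit_act)
      ultimately have "mul j (\<beta> x y) + mul j (\<beta> x y) = \<beta> (act j x) y + \<beta> x (act j y)"
        using U by simp
      then show "mul j (\<beta> x y) = scaleJ (1/2) (\<beta> (act j x) y + \<beta> x (act j y))"
        by (metis half scale_right_distrib)
    qed
  next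
    assume M: ?M
    have M2: "\<beta> (act j x) y + \<beta> x (act j y) = mul j (\<beta> x y) + mul j (\<beta> x y)" for j x y
      using M half by simp
    show ?U
    proof (intro allI)
      fix j x y
      let ?c = "\<beta> (act j x) (act j y)"
      let ?A = "mul j (\<beta> (act j x) y)" and ?B = "mul j (\<beta> x (act j y))"
      have A: "?A + ?A = \<beta> (act (mul j j) x) y + ?c"
        using M2[of j "act j x" y] by (simp add: sq)
      have B: "?B + ?B = ?c + \<beta> x (act (mul j j) y)"
        using M2[of j x "act j y"] by (simp add: sq)
      have AB: "?A + ?B = scaleJ 2 (mul j (mul j (\<beta> x y)))"
        using arg_cong[OF M2[of j x y], of "mul j"] by (simp add: m double)
      have "scaleJ 2 (scaleJ 2 (mul j (mul j (\<beta> x y)))) = (?A + ?B) + (?A + ?B)"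
        by (simp only: AB double)
      also have "\<dots> = (?A + ?A) + (?B + ?B)"
        by (simp only: ac_simps)
      also have "\<dots> = (\<beta> (act (mul j j) x) y + ?c) + (?c + \<beta> x (act (mul j j) y))"
        by (simp only: A B)
      also have "\<dots> = (\<beta> (act (mul j j) x) y + \<beta> x (act (mul j j) y)) + scaleJ 2 ?c"
        by (simp add: double ac_simps)
      also have "\<dots> = scaleJ 2 (mul (mul j j) (\<beta> x y) + ?c)"
        by (simp add: M2 double scale_right_distrib)
      finally have "scaleJ 2 (mul j (mul j (\<beta> x y))) = mul (mul j j) (\<beta> x y) + ?c"
        using two by (simp only: scale_cancel_left) simp
      then show "U_operator scaleJ mul j (\<beta> x y) = ?c"
        by (simp add: U_operator_def)
    qed
  qed
qed


section \<open>Quadrangular algebras\<close>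

definition qa_conj ::
  "('k::field \<Rightarrow> 'l::ab_group_add \<Rightarrow> 'l) \<Rightarrow> ('l \<Rightarrow> 'k) \<Rightarrow> 'l \<Rightarrow> 'l \<Rightarrow> 'l" where
  "qa_conj s q e v = s (polar q e v) e - v"

definition qa_inverse ::
  "('k::field \<Rightarrow> 'l::ab_group_add \<Rightarrow> 'l) \<Rightarrow> ('l \<Rightarrow> 'k) \<Rightarrow> 'l \<Rightarrow> 'l \<Rightarrow> 'l" where
  "qa_inverse s q e v = s (1 / q v) (qa_conj s q e v)"

definition qa_theta ::
  "('k::field \<Rightarrow> 'l::ab_group_add \<Rightarrow> 'l) \<Rightarrow> ('x \<Rightarrow> 'l \<Rightarrow> 'x) \<Rightarrow> ('x \<Rightarrow> 'x \<Rightarrow> 'l) \<Rightarrow> 'x \<Rightarrow> 'l \<Rightarrow> 'l" where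
  "qa_theta s dot h x v = s (1/2) (h x (dot x v))"

definition qa_pi ::
  "('k::field \<Rightarrow> 'l::ab_group_add \<Rightarrow> 'l) \<Rightarrow> 'l \<Rightarrow> ('x \<Rightarrow> 'l \<Rightarrow> 'x) \<Rightarrow> ('x \<Rightarrow> 'x \<Rightarrow> 'l) \<Rightarrow> 'x \<Rightarrow> 'l" where
  "qa_pi s e dot h x = qa_theta s dot h x e"

text \<open>
  The spaces \<open>L\<close> and \<open>X\<close> are subspaces of ambient spaces with scalar multiplications \<open>sL\<close> and
  \<open>sX\<close>; that the maps \<open>dot\<close> and \<open>h\<close> take values in \<open>X\<close> and \<open>L\<close> is part of \<open>A1\<close> and \<open>B1\<close>.
\<close>

locale quadrangular_algebra =
  L: vector_space sL + X: vector_space sX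
  for sL :: "'k::field \<Rightarrow> 'l::ab_group_add \<Rightarrow> 'l"
    and sX :: "'k \<Rightarrow> 'x::ab_group_add \<Rightarrow> 'x" +
  fixes L :: "'l set" and q :: "'l \<Rightarrow> 'k" and e :: 'l
    and X :: "'x set" and dot :: "'x \<Rightarrow> 'l \<Rightarrow> 'x" and h :: "'x \<Rightarrow> 'x \<Rightarrow> 'l"
  assumes char_neq_2: "CHAR('k) \<noteq> 2"
    and L_subspace: "L.subspace L"
    and X_subspace: "X.subspace X"
    and X_nontrivial: "X \<noteq> {0}"
    and q_quadratic: "quadratic_form_on sL L q"
    and q_anisotropic: "anisotropic_on L q"
    and e_in_L: "e \<in> L"
    and q_e: "q e = 1"
    and A1: "bilinear_on sX X sL L sX X dot"
    and A2: "x \<in> X \<Longrightarrow> dot x e = x"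
    and A3: "x \<in> X \<Longrightarrow> v \<in> L \<Longrightarrow> v \<noteq> 0 \<Longrightarrow> dot (dot x v) (qa_inverse sL q e v) = x"
    and B1: "bilinear_on sX X sX X sL L h"
    and B2: "x \<in> X \<Longrightarrow> y \<in> X \<Longrightarrow> v \<in> L \<Longrightarrow>
      h x (dot y v) = h y (dot x v) + sL (polar q (h x y) e) v"
    and B3: "x \<in> X \<Longrightarrow> y \<in> X \<Longrightarrow> v \<in> L \<Longrightarrow> polar q (h (dot x v) y) e = polar q (h x y) v"
    and D1: "x \<in> X \<Longrightarrow> v \<in> L \<Longrightarrow>
      dot x (qa_theta sL dot h x v) = dot (dot x (qa_pi sL e dot h x)) v"
    and D2: "x \<in> X \<Longrightarrow> x \<noteq> 0 \<Longrightarrow> qa_pi sL e dot h x \<noteq> 0"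

end

theory Submission
  imports Defs
begin

text \<open>
  A special module over the reduced spin factor is a module over the Clifford algebra of \<open>q\<close> in
  which \<open>e\<^sub>0\<close> and \<open>e\<^sub>1\<close> act as complementary projections that are swapped by every \<open>v \<in> V\<close>.
  Hence \<open>X = X\<^sub>0 \<oplus> X\<^sub>1\<close> and \<open>u v u = v\<^sup>\<sigma>\<close> as operators, which gives A1--A3. Compatibility of
  \<open>\<beta>\<close> with the projections sends \<open>X\<^sub>i \<times> X\<^sub>i\<close> to \<open>k e\<^sub>i\<close> and \<open>X\<^sub>1 \<times> X\<^sub>0\<close> to \<open>V\<close>; comparing
  components in \<open>v \<beta>(x, y) = (\<beta>(v x, y) + \<beta>(x, v y)) / 2\<close> gives B1--B3. Finally D1 reduces to the
  assumed cubic identity at \<open>v\<^sup>\<sigma>\<close>, since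
  \<open>\<beta>(u x, v u x) u x = - U\<^sub>u \<beta>(v\<^sup>\<sigma> x, x) u x = - u \<beta>(v\<^sup>\<sigma> x, x) x\<close>.
\<close>

text \<open>Since U_j 1 = j^2, the module axiom at the unit makes squares act as squares; polarising
  at i + j gives the claim.\<close>

lemma (in special_jordan_module) act_anticommutator:
  "act (mul i j + mul j i) x = act i (act j x) + act j (act i x)"
proof -
  note m = mul_bilinear[unfolded bilinear_on_def, simplified]
  note a = act_bilinear[unfolded bilinear_on_def, simplified]
  have "mul j unit = j" for j
    by (metis mul_commute unit_mul)
  moreover have "scaleJ 2 j = j + j" for j
    using scale_left_distrib[of 1 1 j] by simp
  ultimately have square: "act j (act j x) = act (mul j j) x" for j x
    using U_act[of j unit x] by (simp add: U_operator_def unit_act)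
  show ?thesis
    using square[of "i + j" x] by (simp add: m a square add.commute)
qed

section \<open>Clifford relations in modules over a reduced spin factor\<close>

locale spin_module =
  special_jordan_module "spin_scale s" "spin_mul s q" spin_unit sX act + V: vector_space s
  for s :: "'k::field \<Rightarrow> 'v::ab_group_add \<Rightarrow> 'v" and q :: "'v \<Rightarrow> 'k"
    and sX :: "'k \<Rightarrow> 'x::ab_group_add \<Rightarrow> 'x"
    and act :: "('k, 'v) spin \<Rightarrow> 'x \<Rightarrow> 'x"  (infixr "\<bullet>" 75) +
  assumes char: "CHAR('k) \<noteq> 2"
    and quadratic: "quadratic_form_on s UNIV q"
begin

lemma act_linear:
  "(i + j) \<bullet> x = i \<bullet> x + j \<bullet> x" "j \<bullet> (x + y) = j \<bullet> x + j \<bullet> y"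
  "spin_scale s t j \<bullet> x = sX t (j \<bullet> x)" "j \<bullet> sX t x = sX t (j \<bullet> x)"
  using act_bilinear unfolding bilinear_on_def by blast+

lemma two: "(2::'k) \<noteq> 0"
  by (rule two_neq_zero_if_char) (rule char)

lemma half_add_half: "x / 2 + x / 2 = (x::'k)"
  using two by (metis add_divide_distrib mult_2 nonzero_mult_div_cancel_left)

lemma scale_half_eq_iff: "s (1/2) v = w \<longleftrightarrow> v = w + w"
proof -
  have "w + w = s 2 w"
    using V.scale_left_distrib[of 1 1 w] by simp
  then show ?thesis
    using two by auto
qed

lemma q_scale: "q (s t v) = t\<^sup>2 * q v"
  using quadratic unfolding quadratic_form_on_def by simp

lemma polar_commute: "polar q v w = polar q w v"
  by (simp add: polar_def add.commute)

lemma polar_zero [simp]: "polar q 0 v = 0" "polar q v 0 = 0"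
  using q_scale[of 0 0] by (simp_all add: polar_def)

lemma polar_self: "polar q v v = 2 * q v"
  using q_scale[of 2 v] V.scale_left_distrib[of 1 1 v] by (simp add: polar_def)

lemma spin_V_linear:
  "spin_V (v + w) = spin_V v + (spin_V w :: ('k, 'v) spin)"
  "spin_V (v - w) = spin_V v - (spin_V w :: ('k, 'v) spin)"
  "spin_V (s t v) = spin_scale s t (spin_V v)"
  by (simp_all add: spin_V_def spin_scale_def)

lemma act_zero [simp]: "j \<bullet> 0 = 0" "0 \<bullet> x = 0"
  using act_linear(2)[of j 0 0] act_linear(1)[of 0 0 x] by simp_all

lemma act_uminus: "j \<bullet> (- x) = - (j \<bullet> x)" "(- j) \<bullet> x = - (j \<bullet> x)"
  using act_linear(2)[of j x "- x"] act_linear(1)[of j "- j" x]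
  by (simp_all add: eq_neg_iff_add_eq_0 add.commute)

lemma act_diff: "j \<bullet> (x - y) = j \<bullet> x - j \<bullet> y" "(i - j) \<bullet> x = i \<bullet> x - j \<bullet> x"
  using act_linear(2)[of j x "- y"] act_linear(1)[of i "- j" x]
  by (simp_all add: act_uminus)

text \<open>In the spin factor e0 v + v e0 = v, so each v maps the image of e0 into its kernel and
  the kernel into the image.\<close>

lemma e0_act_V: "spin_e0 \<bullet> spin_V v \<bullet> x = spin_V v \<bullet> (x - spin_e0 \<bullet> x)"
proof -
  have "spin_mul s q spin_e0 (spin_V v) + spin_mul s q (spin_V v) spin_e0 = spin_V v"
    by (simp add: spin_mul_def spin_e0_def spin_V_def half_add_half flip: V.scale_left_distrib)
  with act_anticommutator[of spin_e0 "spin_V v" x] show ?thesis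
    by (simp add: act_diff algebra_simps)
qed

lemma e0_idem: "spin_e0 \<bullet> spin_e0 \<bullet> x = spin_e0 \<bullet> x"
proof -
  have "U_operator (spin_scale s) (spin_mul s q) spin_e0 spin_unit = spin_e0"
    by (simp add: U_operator_def spin_mul_def spin_scale_def spin_e0_def spin_e1_def spin_unit_def zero_prod_def)
  then show ?thesis
    using U_act[of spin_e0 spin_unit x] by (simp add: unit_act)
qed

lemma V_anticommutator:
  "spin_V v \<bullet> spin_V w \<bullet> x + spin_V w \<bullet> spin_V v \<bullet> x = sX (polar q v w) x"
proof -
  have "spin_mul s q (spin_V v) (spin_V w) + spin_mul s q (spin_V w) (spin_V v) =
      spin_scale s (polar q v w) spin_unit"
    by (simp add: spin_mul_def spin_V_def spin_scale_def spin_unit_def spin_e0_def spin_e1_def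
        half_add_half polar_commute[of w v])
  then have "sX (polar q v w) x =
      (spin_mul s q (spin_V v) (spin_V w) + spin_mul s q (spin_V w) (spin_V v)) \<bullet> x"
    by (simp only: act_linear unit_act)
  also have "\<dots> = spin_V v \<bullet> spin_V w \<bullet> x + spin_V w \<bullet> spin_V v \<bullet> x"
    by (rule act_anticommutator)
  finally show ?thesis ..
qed

lemma V_square: "spin_V v \<bullet> spin_V v \<bullet> x = sX (q v) x"
proof -
  have "sX 2 (spin_V v \<bullet> spin_V v \<bullet> x) = sX 2 (sX (q v) x)"
    using V_anticommutator[of v v x] X.scale_left_distrib[of 1 1 "spin_V v \<bullet> spin_V v \<bullet> x"]
    by (simp add: polar_self)
  then show ?thesis
    using two by (simp only: X.scale_cancel_left) simp
qed

end

locale pointed_spin_module = spin_module s q sX act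
  for s :: "'k::field \<Rightarrow> 'v::ab_group_add \<Rightarrow> 'v" and q :: "'v \<Rightarrow> 'k"
    and sX :: "'k \<Rightarrow> 'x::ab_group_add \<Rightarrow> 'x"
    and act :: "('k, 'v) spin \<Rightarrow> 'x \<Rightarrow> 'x"  (infixr "\<bullet>" 75) +
  fixes u :: 'v
  assumes base_point: "q u = 1"
begin

lemma u_square [simp]: "spin_V u \<bullet> spin_V u \<bullet> x = x"
  by (simp add: V_square base_point)

text \<open>The Clifford relation replaces u v by f(u, v) - v u, and u u = 1 cancels the trailing
  pair.\<close>

lemma u_V_u: "spin_V u \<bullet> spin_V v \<bullet> spin_V u \<bullet> x = spin_V (qa_conj s q u v) \<bullet> x"
  using V_anticommutator[of u v "spin_V u \<bullet> x"]
  by (simp add: qa_conj_def spin_V_linear act_diff act_linear eq_diff_eq)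

end

section \<open>Peirce components of the form\<close>

locale spin_module_form = pointed_spin_module s q sX act u
  for s :: "'k::field \<Rightarrow> 'v::ab_group_add \<Rightarrow> 'v" and q :: "'v \<Rightarrow> 'k"
    and sX :: "'k \<Rightarrow> 'x::ab_group_add \<Rightarrow> 'x"
    and act :: "('k, 'v) spin \<Rightarrow> 'x \<Rightarrow> 'x"  (infixr "\<bullet>" 75) and u :: 'v +
  fixes \<beta> :: "'x \<Rightarrow> 'x \<Rightarrow> ('k, 'v) spin" and X0 :: "'x set"
  assumes \<beta>_bilinear: "bilinear_on sX UNIV sX UNIV (spin_scale s) UNIV \<beta>"
    and \<beta>_skew: "\<beta> x y = - \<beta> y x"
    and \<beta>_U: "U_operator (spin_scale s) (spin_mul s q) j (\<beta> x y) = \<beta> (j \<bullet> x) (j \<bullet> y)"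
    and \<beta>_mul: "spin_mul s q j (\<beta> x y) = spin_scale s (1/2) (\<beta> (j \<bullet> x) y + \<beta> x (j \<bullet> y))"
    and X0_def: "X0 = {x. spin_e0 \<bullet> x = x}"
begin

lemma \<beta>_linear:
  "\<beta> (x + y) z = \<beta> x z + \<beta> y z" "\<beta> x (y + z) = \<beta> x y + \<beta> x z"
  "\<beta> (sX t x) y = spin_scale s t (\<beta> x y)" "\<beta> x (sX t y) = spin_scale s t (\<beta> x y)"
  using \<beta>_bilinear unfolding bilinear_on_def by blast+

text \<open>The projection makes \<open>h\<close> total with values in \<open>'v\<close>; on
  \<open>X0\<close> nothing is lost, by \<open>\<beta>_u\<close>.\<close>

definition h where "h x y = spin_V_part (\<beta> (spin_V u \<bullet> x) y)"

text \<open>A single vector would move \<open>X0\<close> into the kernel of e0; acting first with u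
  brings the product back to \<open>X0\<close>.\<close>

definition dot where "dot x v = spin_V v \<bullet> spin_V u \<bullet> x"

lemma \<beta>_zero [simp]: "\<beta> x 0 = 0" "\<beta> 0 x = 0"
  using \<beta>_linear(2)[of x 0 0] \<beta>_linear(1)[of 0 0 x] by simp_all

text \<open>Multiplication by e0 is 1, 1/2, 0 on the three summands of J. By
  \<open>\<beta>_mul\<close>, if e0 has eigenvalues a on x and b on y, then it has eigenvalue (a +
  b)/2 on \<open>\<beta> x y\<close>, which locates that value in one summand.\<close>

lemma e0_mul_\<beta>:
  "spin_mul s q spin_e0 (\<beta> x y) = (fst (\<beta> x y), s (1/2) (spin_V_part (\<beta> x y)), 0)"
  by (cases "\<beta> x y") (simp add: spin_mul_def spin_e0_def spin_V_part_def)

lemma \<beta>_X0_X0: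
  assumes "x \<in> X0" "y \<in> X0" shows "\<beta> x y = (fst (\<beta> x y), 0, 0)"
proof -
  have "spin_mul s q spin_e0 (\<beta> x y) = \<beta> x y"
    using assms \<beta>_mul[of spin_e0 x y] unfolding X0_def
    by (cases "\<beta> x y") (simp add: spin_scale_def half_add_half two V.scale_right_distrib
        flip: V.scale_left_distrib)
  then show ?thesis
    unfolding e0_mul_\<beta> by (cases "\<beta> x y") (auto simp: spin_V_part_def scale_half_eq_iff)
qed

lemma \<beta>_X1_X1:
  assumes "spin_e0 \<bullet> x = 0" "spin_e0 \<bullet> y = 0" shows "\<beta> x y = (0, 0, snd (snd (\<beta> x y)))"
proof -
  have "spin_mul s q spin_e0 (\<beta> x y) = 0"
    using assms \<beta>_mul[of spin_e0 x y] by (simp add: spin_scale_def zero_prod_def)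
  then show ?thesis
    unfolding e0_mul_\<beta>
    by (cases "\<beta> x y") (auto simp: spin_V_part_def two zero_prod_def)
qed

lemma \<beta>_X1_X0:
  assumes "spin_e0 \<bullet> x = 0" "y \<in> X0" shows "\<beta> x y = spin_V (spin_V_part (\<beta> x y))"
proof -
  have "spin_mul s q spin_e0 (\<beta> x y) = spin_scale s (1/2) (\<beta> x y)"
    using assms \<beta>_mul[of spin_e0 x y] unfolding X0_def by simp
  \<comment> \<open>The V-components agree automatically; only the two outer components are
    constrained.\<close>
  then have "fst (\<beta> x y) = fst (\<beta> x y) / 2" "snd (snd (\<beta> x y)) = 0"
    unfolding e0_mul_\<beta> using two by (cases "\<beta> x y"; simp add: spin_scale_def)+
  moreover have "a = a / 2 \<Longrightarrow> a = 0" for a :: 'k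
    using half_add_half[of a] by (metis add_cancel_right_right)
  ultimately have "fst (\<beta> x y) = 0" "snd (snd (\<beta> x y)) = 0"
    by blast+
  then show ?thesis
    by (cases "\<beta> x y") (simp add: spin_V_def spin_V_part_def)
qed

lemma e0_V_X0: "x \<in> X0 \<Longrightarrow> spin_e0 \<bullet> spin_V v \<bullet> x = 0"
  by (simp add: e0_act_V X0_def)

lemma dot_X0: "x \<in> X0 \<Longrightarrow> dot x v \<in> X0"
  using e0_V_X0[of x u] by (simp add: dot_def X0_def e0_act_V[of v])

lemma \<beta>_u: "x \<in> X0 \<Longrightarrow> y \<in> X0 \<Longrightarrow> \<beta> (spin_V u \<bullet> x) y = spin_V (h x y)"
  unfolding h_def by (intro \<beta>_X1_X0 e0_V_X0)

section \<open>The space \<open>X0\<close>, bilinearity and the inverse law\<close>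

lemma subspace_X0: "X.subspace X0"
  by (simp add: X.subspace_def X0_def act_linear)

text \<open>If e0 acted as 0, then e0 v = v (1 - e0) would make every v act as 0, whereas u is an
  involution.\<close>

lemma X0_nontrivial:
  assumes "(x::'x) \<noteq> 0" shows "X0 \<noteq> {0}"
proof
  assume X0: "X0 = {0}"
  have "spin_e0 \<bullet> y = 0" for y
  proof -
    have "spin_e0 \<bullet> y \<in> X0"
      by (simp add: X0_def e0_idem)
    with X0 show ?thesis by simp
  qed
  then have "spin_V u \<bullet> y = 0" for y
    using e0_act_V[of u y] by simp
  with u_square[of x] assms show False by metis
qed

lemma h_linear:
  "h (x + x') y = h x y + h x' y" "h x (y + y') = h x y + h x y'"
  "h (sX t x) y = s t (h x y)" "h x (sX t y) = s t (h x y)"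
  by (simp_all add: h_def act_linear \<beta>_linear spin_V_part_def)
    (simp_all add: spin_scale_def split: prod.split)

lemma dot_linear:
  "dot (x + x') v = dot x v + dot x' v" "dot x (v + w) = dot x v + dot x w"
  "dot (sX t x) v = sX t (dot x v)" "dot x (s t v) = sX t (dot x v)"
  by (simp_all add: dot_def act_linear spin_V_linear)

lemma dot_base_point: "dot x u = x"
  by (simp add: dot_def)

lemma dot_inverse:
  assumes "q v \<noteq> 0" shows "dot (dot x v) (qa_inverse s q u v) = x"
proof -
  \<comment> \<open>With the conjugate written as u v u, the operator is u v u u v u = u v v u =
    q(v).\<close>
  have "dot (dot x v) (qa_conj s q u v) = sX (q v) x"
    by (simp add: dot_def act_linear V_square[of v] flip: u_V_u)
  with assms show ?thesis
    by (simp add: qa_inverse_def dot_linear)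
qed

section \<open>Axioms B2 and B3 by comparing components\<close>

text \<open>Compare e0-components in \<open>\<beta>_mul\<close> for v and the pair (u x, y): the
  summand \<beta>(u x, v y) lies in k e1 and drops out.\<close>

lemma polar_h_V:
  assumes "x \<in> X0" "y \<in> X0"
  shows "polar q (h x y) v = fst (\<beta> (dot x v) y)"
proof -
  have "\<beta> (spin_V u \<bullet> x) (spin_V v \<bullet> y) = (0, 0, snd (snd (\<beta> (spin_V u \<bullet> x) (spin_V v \<bullet> y))))"
    using assms by (intro \<beta>_X1_X1 e0_V_X0)
  then have "fst (\<beta> (spin_V u \<bullet> x) (spin_V v \<bullet> y)) = 0"
    by (metis fst_conv)
  moreover have "fst (spin_mul s q (spin_V v) (\<beta> (spin_V u \<bullet> x) y)) = polar q (h x y) v / 2"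
    unfolding \<beta>_u[OF assms] by (simp add: spin_mul_def spin_V_def polar_commute[of v])
  moreover have "fst (spin_scale s t j) = t * fst j" for t and j :: "('k, 'v) spin"
    by (cases j) (simp add: spin_scale_def)
  ultimately show ?thesis
    using two \<beta>_mul[of "spin_V v" "spin_V u \<bullet> x" y] by (simp add: dot_def)
qed

text \<open>Compare e1-components in \<open>\<beta>_mul\<close> for u and the pair (u x, y): since u
  u x = x, the other summand is \<beta>(x, y), which lies in k e0.\<close>

lemma \<beta>_u_u:
  assumes "x \<in> X0" "y \<in> X0"
  shows "\<beta> (spin_V u \<bullet> x) (spin_V u \<bullet> y) = (0, 0, polar q (h x y) u)"
proof -
  have "\<beta> x y = (fst (\<beta> x y), 0, 0)"
    using assms by (rule \<beta>_X0_X0)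
  then have "snd (snd (\<beta> x y)) = 0"
    by (metis snd_conv)
  moreover have "snd (snd (spin_mul s q (spin_V u) (\<beta> (spin_V u \<bullet> x) y))) = polar q (h x y) u / 2"
    unfolding \<beta>_u[OF assms] by (simp add: spin_mul_def spin_V_def polar_commute[of u])
  moreover have "snd (snd (spin_scale s t j)) = t * snd (snd j)" for t and j :: "('k, 'v) spin"
    by (cases j) (simp add: spin_scale_def)
  ultimately have "snd (snd (\<beta> (spin_V u \<bullet> x) (spin_V u \<bullet> y))) = polar q (h x y) u"
    using two \<beta>_mul[of "spin_V u" "spin_V u \<bullet> x" y] by simp
  then show ?thesis
    using \<beta>_X1_X1[OF e0_V_X0[OF assms(1)] e0_V_X0[OF assms(2)], of u u] by simp
qed

text \<open>Compare V-components in \<open>\<beta>_mul\<close> for v and the pair (u x, u y), whose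
  form value is a multiple of e1; skewness turns the first summand into -h(y, x v).\<close>

lemma h_dot_right:
  assumes "x \<in> X0" "y \<in> X0"
  shows "h x (dot y v) = h y (dot x v) + s (polar q (h x y) u) v"
proof -
  let ?x = "spin_V u \<bullet> x" and ?y = "spin_V u \<bullet> y"
  let ?c = "polar q (h x y) u"
  have "spin_V_part (spin_mul s q (spin_V v) (\<beta> ?x ?y)) = s (1/2) (s ?c v)"
    unfolding \<beta>_u_u[OF assms] by (simp add: spin_mul_def spin_V_def spin_V_part_def)
  moreover have "spin_V_part (spin_scale s t j) = s t (spin_V_part j)"
    for t and j :: "('k, 'v) spin"
    by (cases j) (simp add: spin_scale_def spin_V_part_def)
  ultimately have "s (1/2) (s ?c v) =
      s (1/2) (spin_V_part (\<beta> (spin_V v \<bullet> ?x) ?y + \<beta> ?x (spin_V v \<bullet> ?y)))"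
    by (simp only: \<beta>_mul)
  then have "s ?c v = spin_V_part (\<beta> (spin_V v \<bullet> ?x) ?y + \<beta> ?x (spin_V v \<bullet> ?y))"
    using two by (simp only: V.scale_cancel_left) simp
  also have "\<dots> = h x (dot y v) - h y (dot x v)"
    using \<beta>_skew[of "spin_V v \<bullet> ?x" ?y] by (simp add: h_def dot_def spin_V_part_def)
  finally show ?thesis by simp
qed

text \<open>By \<open>polar_h_V\<close> and (x v) u = x v, both sides are the e0-component of
  \<beta>(x v, y).\<close>

lemma polar_h_dot:
  assumes "x \<in> X0" "y \<in> X0"
  shows "polar q (h (dot x v) y) u = polar q (h x y) v"
  using assms by (simp add: polar_h_V dot_X0 dot_base_point)

section \<open>The cubic identity and the axioms D1 and D2\<close>

lemma dot_h_dot: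
  assumes cubic: "\<And>x v. x \<in> X0 \<Longrightarrow>
      \<beta> (spin_V v \<bullet> x) x \<bullet> x = spin_V v \<bullet> spin_V u \<bullet> \<beta> (spin_V u \<bullet> x) x \<bullet> x"
    and "x \<in> X0"
  shows "dot x (h x (dot x v)) = dot (dot x (h x x)) v"
proof -
  let ?w = "qa_conj s q u v"
  let ?U = "U_operator (spin_scale s) (spin_mul s q) (spin_V u)"
  have uw: "spin_V u \<bullet> spin_V ?w \<bullet> x = spin_V v \<bullet> spin_V u \<bullet> x" for x
    by (simp flip: u_V_u)
  \<comment> \<open>Skewness puts v u x first; rewriting it as u w x exhibits a common factor u in
    both arguments, which \<open>\<beta>_U\<close> extracts.\<close>
  have neg: "spin_V (h x (dot x v)) = - ?U (\<beta> (spin_V ?w \<bullet> x) x)"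
    using \<beta>_u[OF \<open>x \<in> X0\<close> dot_X0[OF \<open>x \<in> X0\<close>], of v] \<beta>_skew[of "spin_V u \<bullet> x" "dot x v"]
    by (simp add: \<beta>_U uw dot_def)
  have "dot x (h x (dot x v)) = - (spin_V u \<bullet> \<beta> (spin_V ?w \<bullet> x) x \<bullet> x)"
    by (simp only: dot_def[of x "h x (dot x v)"] neg act_uminus U_act u_square)
  \<comment> \<open>The cubic identity at w produces u w u, which is v u u = v.\<close>
  also have "\<dots> = - (spin_V v \<bullet> \<beta> (spin_V u \<bullet> x) x \<bullet> x)"
    by (simp only: cubic[OF \<open>x \<in> X0\<close>, of ?w] uw u_square)
  \<comment> \<open>The sign is absorbed because U_u \<beta>(u x, x) = \<beta>(x, u x) = -\<beta>(u
    x, x).\<close>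
  also have "\<dots> = spin_V v \<bullet> ?U (\<beta> (spin_V u \<bullet> x) x) \<bullet> x"
    using \<beta>_skew[of x "spin_V u \<bullet> x"] by (simp add: \<beta>_U act_uminus)
  also have "\<dots> = dot (dot x (h x x)) v"
    using \<open>x \<in> X0\<close> by (simp add: U_act \<beta>_u dot_def)
  finally show ?thesis .
qed

lemma quadrangular_algebra_X0:
  assumes "anisotropic_on UNIV q" and "(x::'x) \<noteq> 0"
    and cubic: "\<And>x v. x \<in> X0 \<Longrightarrow>
      \<beta> (spin_V v \<bullet> x) x \<bullet> x = spin_V v \<bullet> spin_V u \<bullet> \<beta> (spin_V u \<bullet> x) x \<bullet> x"
    and nonzero: "\<And>x. x \<in> X0 \<Longrightarrow> x \<noteq> 0 \<Longrightarrow> \<beta> (spin_V u \<bullet> x) x \<noteq> 0"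
  shows "quadrangular_algebra s sX UNIV q u X0 dot h"
proof
  show "X0 \<noteq> {0}"
    using assms(2) by (rule X0_nontrivial)
  show "bilinear_on sX X0 s UNIV sX X0 dot" "bilinear_on sX X0 sX X0 s UNIV h"
    by (simp_all add: bilinear_on_def dot_linear h_linear dot_X0)
  show "dot (dot x v) (qa_inverse s q u v) = x" if "v \<noteq> 0" for x v
    using that assms(1) by (intro dot_inverse) (auto simp: anisotropic_on_def)
  show "dot x (qa_theta s dot h x v) = dot (dot x (qa_pi s u dot h x)) v" if "x \<in> X0" for x v
    using dot_h_dot[OF cubic that] by (simp add: qa_theta_def qa_pi_def dot_base_point dot_linear)
  \<comment> \<open>Here \<pi>(x) is half of h(x, x), whose image in J is the nonzero value
    \<beta>(u x, x).\<close>
  show "qa_pi s u dot h x \<noteq> 0" if "x \<in> X0" "x \<noteq> 0" for x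
    using nonzero[OF that] \<beta>_u[OF that(1) that(1)] two
    by (auto simp: qa_pi_def qa_theta_def dot_base_point spin_V_def zero_prod_def)
  show "h x (dot y v) = h y (dot x v) + s (polar q (h x y) u) v" if "x \<in> X0" "y \<in> X0" for x y v
    using that by (rule h_dot_right)
qed (simp_all add: char subspace_X0 quadratic assms(1) base_point dot_base_point polar_h_dot)

end

theorem theorem3p5:
  fixes scaleV :: "'k::field \<Rightarrow> 'v::ab_group_add \<Rightarrow> 'v"
    and scaleX :: "'k \<Rightarrow> 'x::ab_group_add \<Rightarrow> 'x"
    and q :: "'v \<Rightarrow> 'k" and u :: 'v
    and act :: "('k, 'v) spin \<Rightarrow> 'x \<Rightarrow> 'x"  (infixr "\<bullet>" 75)
    and \<beta> :: "'x \<Rightarrow> 'x \<Rightarrow> ('k, 'v) spin"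
    and X0 :: "'x set"
    and dot :: "'x \<Rightarrow> 'v \<Rightarrow> 'x"
    and h :: "'x \<Rightarrow> 'x \<Rightarrow> 'v"
  assumes char: "CHAR('k) \<noteq> 2"
    and V: "vector_space scaleV"
    and q: "quadratic_form_on scaleV UNIV q"
    and q_nondegenerate: "nondegenerate_on UNIV q"
    and q_anisotropic: "anisotropic_on UNIV q"
    and base_point: "q u = 1"
    and X_module: "special_jordan_module (spin_scale scaleV) (spin_mul scaleV q) spin_unit scaleX act"
    and X_nontrivial: "\<exists>x::'x. x \<noteq> 0"
    and \<beta>_bilinear: "bilinear_on scaleX UNIV scaleX UNIV (spin_scale scaleV) UNIV \<beta>"
    and \<beta>_skew: "\<forall>x y. \<beta> x y = - \<beta> y x"
    and \<beta>_U: "\<forall>j x y. U_operator (spin_scale scaleV) (spin_mul scaleV q) j (\<beta> x y) = \<beta> (j \<bullet> x) (j \<bullet> y)"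
    and \<beta>_mul: "\<forall>j x y. spin_mul scaleV q j (\<beta> x y) =
                   spin_scale scaleV (1/2) (\<beta> (j \<bullet> x) y + \<beta> x (j \<bullet> y))"
    and X0_def: "X0 = {x. spin_e0 \<bullet> x = x}"
    and \<beta>_X0: "\<forall>x\<in>X0. \<forall>v. \<beta> (spin_V v \<bullet> x) x \<bullet> x = spin_V v \<bullet> spin_V u \<bullet> \<beta> (spin_V u \<bullet> x) x \<bullet> x"
    and \<beta>_nonzero: "\<forall>x\<in>X0 - {0}. \<beta> (spin_V u \<bullet> x) x \<noteq> 0"
    and dot_def: "dot = (\<lambda>x v. spin_V v \<bullet> spin_V u \<bullet> x)"
    and h_def: "h = (\<lambda>x y. spin_V_part (\<beta> (spin_V u \<bullet> x) y))"
  shows "(\<forall>x\<in>X0. \<forall>y\<in>X0. \<beta> (spin_V u \<bullet> x) y = spin_V (h x y)) \<and>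
         quadrangular_algebra scaleV scaleX UNIV q u X0 dot h"
proof -
  interpret special_jordan_module "spin_scale scaleV" "spin_mul scaleV q" spin_unit scaleX act
    by (rule X_module)
  interpret V: vector_space scaleV
    by (rule V)
  interpret S: spin_module_form scaleV q scaleX act u \<beta> X0
    by unfold_locales
      (fact char q base_point \<beta>_bilinear X0_def \<beta>_skew[rule_format] \<beta>_U[rule_format] \<beta>_mul[rule_format])+
  have "dot = S.dot" "h = S.h"
    unfolding dot_def h_def S.dot_def S.h_def by (rule refl)+
  moreover obtain x :: 'x where "x \<noteq> 0"
    using X_nontrivial by blast
  ultimately show ?thesis
    using S.quadrangular_algebra_X0[OF q_anisotropic _ \<beta>_X0[rule_format]] \<beta>_nonzero S.\<beta>_u
    by blast
qed

end
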